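(* Let $(\mathcal{T}_n)_{n\ge1}$ be a sequence of size-conditioned simply generated trees of type I, II or III, and let $v_n$ be a uniformly chosen vertex of $\mathcal{T}_n$. There is $n_0\ge1$, depending only on the weight sequence, such that for every $p\ge0$, \[ \sup_{n\ge n_0}\mathbf E\bigl[\partial(\mathcal{T}_n,v_n)^p\bigr]<+\infty, \] and the family $\{\partial(\mathcal{T}_n,v_n)\}_{n\ge1}$ is uniformly integrable of every order; that is, for every real $p\ge 0$ the family $\{\partial(\mathcal{T}_n,v_n)^p\}_{n\ge1}$ is uniformly integrable (here $n$ ranges only over values for which $\mathcal{T}_n$ is defined).
   Context: **Simply generated trees.** A weight sequence is a sequence $\mathbf w=(\omega_k)_{k\ge0}$ of non-negative reals with $\omega_0>0$ and $\omega_k>0$ for at least one $k\ge2$. For $n\ge 1$, $\mathcal{T}_n$ is the random rooted plane tree with $n$ vertices such that $\mathbf P(\mathcal{T}_n=T)$ is proportional to $\prod_{v\in T}\omega_{d_T^+(v)}$ for each $n$-vertex rooted plane tree $T$, where $d_T^+(v)$ is the outdegree (number of children) of $v$. Throughout, only those $n$ are considered for which some $n$-vertex tree has positive weight ("$\mathcal{T}_n$ is defined"). The vertex $v_n$ is uniform among the vertices of $\mathcal{T}_n$, conditionally on $\mathcal{T}_n$. **Types.** Let $\Phi(z)=\sum_{k\ge0}\omega_kz^k$ with radius of convergence $R\in[0,\infty]$. Type I: there is a (finite) $\tau\in(0,R]$ with $\Phi(\tau)<\infty$ and $\tau\Phi'(\tau)/\Phi(\tau)=1$. Type II: $R>0$,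 $\Phi(R)<\infty$ and $R\Phi'(R)/\Phi(R)<1$. Type III: $R=0$. **Distance to the border from a vertex.** A leaf is a vertex with no children. For a vertex $v$ of a finite rooted tree $T$, $\partial(T,v)$ is the minimal graph distance from $v$ to a leaf of $T$ (not necessarily a descendant of $v$). *)

theory Defs
  imports "HOL-Probability.Probability"
begin

section \<open>Rooted plane trees\<close>

datatype plane_tree = Node (children: "plane_tree list")

text \<open>
  Vertices are Ulam--Harris addresses: the root is \<open>[]\<close>, and the \<open>i\<close>-th child (counted from 0)
  of the vertex \<open>u\<close> is \<open>u @ [i]\<close>.
\<close>

type_synonym vertex = "nat list"

fun is_vertex :: "plane_tree \<Rightarrow> vertex \<Rightarrow> bool" where
  "is_vertex T [] \<longleftrightarrow> True"
| "is_vertex T (i # u) \<longleftrightarrow> i < length (children T) \<and> is_vertex (children T ! i) u"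

definition vertices :: "plane_tree \<Rightarrow> vertex set" where
  "vertices T = {u. is_vertex T u}"

fun subtree_at :: "plane_tree \<Rightarrow> vertex \<Rightarrow> plane_tree" where
  "subtree_at T [] = T"
| "subtree_at T (i # u) = subtree_at (children T ! i) u"

definition outdegree :: "plane_tree \<Rightarrow> vertex \<Rightarrow> nat" where
  "outdegree T u = length (children (subtree_at T u))"

definition leaves :: "plane_tree \<Rightarrow> vertex set" where
  "leaves T = {u \<in> vertices T. outdegree T u = 0}"

definition tree_edges :: "plane_tree \<Rightarrow> (vertex \<times> vertex) set" where
  "tree_edges T = {(u, v). u \<in> vertices T \<and> v \<in> vertices T \<and> (\<exists>i. v = u @ [i] \<or> u = v @ [i])}"

definition tree_dist :: "plane_tree \<Rightarrow> vertex \<Rightarrow> vertex \<Rightarrow> nat" where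
  "tree_dist T u v = (LEAST k. (u, v) \<in> tree_edges T ^^ k)"

definition border_dist :: "plane_tree \<Rightarrow> vertex \<Rightarrow> nat" where
  "border_dist T v = Min (tree_dist T v ` leaves T)"

definition plane_trees :: "nat \<Rightarrow> plane_tree set" where
  "plane_trees n = {T. card (vertices T) = n}"

lemma vertices_Node:
  "vertices (Node ts) = insert [] (\<Union>i<length ts. (#) i ` vertices (ts ! i))"
proof -
  have "is_vertex (Node ts) u \<longleftrightarrow> u \<in> insert [] (\<Union>i<length ts. (#) i ` {u. is_vertex (ts ! i) u})" for u
    by (cases u) auto
  then show ?thesis
    unfolding vertices_def by blast
qed

lemma finite_vertices: "finite (vertices T)"
  by (induction T) (auto simp: vertices_Node)

lemma root_in_vertices: "[] \<in> vertices T"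
  by (simp add: vertices_def)

lemma vertices_nonempty: "vertices T \<noteq> {}"
  using root_in_vertices by blast

lemma card_vertices_child_less:
  assumes "i < length ts"
  shows "card (vertices (ts ! i)) < card (vertices (Node ts))"
proof -
  have "card (vertices (ts ! i)) = card ((#) i ` vertices (ts ! i))"
    by (simp add: card_image)
  also have "\<dots> < card (vertices (Node ts))"
    using assms by (intro psubset_card_mono finite_vertices) (auto simp: vertices_Node)
  finally show ?thesis .
qed

lemma length_children_le: "length ts \<le> card (vertices (Node ts))"
proof -
  have "length ts = card ((\<lambda>i. [i]) ` {..<length ts})"
    by (simp add: card_image inj_on_def)
  also have "\<dots> \<le> card (vertices (Node ts))"
    by (intro card_mono finite_vertices) (auto simp: vertices_def)
  finally show ?thesis .
qed

lemma finite_plane_trees: "finite (plane_trees n)"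
proof (induction n rule: less_induct)
  case (less n)
  let ?A = "\<Union>m<n. plane_trees m"
  have "plane_trees n \<subseteq> Node ` {ts. set ts \<subseteq> ?A \<and> length ts \<le> n}"
  proof
    fix T assume T: "T \<in> plane_trees n"
    obtain ts where ts: "T = Node ts" by (cases T)
    have "set ts \<subseteq> ?A"
      using card_vertices_child_less[of _ ts] T
      by (auto simp: ts plane_trees_def in_set_conv_nth)
    moreover have "length ts \<le> n"
      using length_children_le[of ts] T by (simp add: ts plane_trees_def)
    ultimately show "T \<in> Node ` {ts. set ts \<subseteq> ?A \<and> length ts \<le> n}"
      using ts by blast
  qed
  moreover have "finite ?A" using less by simp
  ultimately show ?case
    using finite_subset finite_imageI finite_lists_length_le by metis
qed

section \<open>Simply generated trees\<close>

definition weight_sequence :: "(nat \<Rightarrow> real) \<Rightarrow> bool" where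
  "weight_sequence w \<longleftrightarrow> (\<forall>k. 0 \<le> w k) \<and> 0 < w 0 \<and> (\<exists>k\<ge>2. 0 < w k)"

definition tree_weight :: "(nat \<Rightarrow> real) \<Rightarrow> plane_tree \<Rightarrow> real" where
  "tree_weight w T = (\<Prod>v\<in>vertices T. w (outdegree T v))"

definition sg_tree_defined :: "(nat \<Rightarrow> real) \<Rightarrow> nat \<Rightarrow> bool" where
  "sg_tree_defined w n \<longleftrightarrow> (\<exists>T\<in>plane_trees n. 0 < tree_weight w T)"

definition partition_function :: "(nat \<Rightarrow> real) \<Rightarrow> nat \<Rightarrow> real" where
  "partition_function w n = (\<Sum>T\<in>plane_trees n. tree_weight w T)"

text \<open>
  The law of the simply generated tree with \<open>n\<close> vertices. The value is meaningful only if
  \<open>sg_tree_defined w n\<close> holds; see \<open>pmf_sg_tree\<close> below.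
\<close>

definition sg_tree :: "(nat \<Rightarrow> real) \<Rightarrow> nat \<Rightarrow> plane_tree pmf" where
  "sg_tree w n =
     embed_pmf (\<lambda>T. if T \<in> plane_trees n then tree_weight w T / partition_function w n else 0)"

text \<open>The joint law of the tree and of a vertex which is uniform conditionally on the tree.\<close>

definition sg_tree_vertex :: "(nat \<Rightarrow> real) \<Rightarrow> nat \<Rightarrow> (plane_tree \<times> vertex) pmf" where
  "sg_tree_vertex w n =
     do {
       T \<leftarrow> sg_tree w n;
       v \<leftarrow> pmf_of_set (vertices T);
       return_pmf (T, v)
     }"

lemma tree_weight_nonneg: "weight_sequence w \<Longrightarrow> 0 \<le> tree_weight w T"
  by (simp add: tree_weight_def weight_sequence_def prod_nonneg)

lemma partition_function_pos:
  assumes "weight_sequence w" "sg_tree_defined w n"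
  shows "0 < partition_function w n"
  using assms unfolding partition_function_def sg_tree_defined_def
  by (auto intro!: sum_pos2 finite_plane_trees tree_weight_nonneg)

lemma pmf_sg_tree:
  assumes "weight_sequence w" "sg_tree_defined w n"
  shows "pmf (sg_tree w n) T =
    (if T \<in> plane_trees n then tree_weight w T / partition_function w n else 0)"
  unfolding sg_tree_def
proof (rule pmf_embed_pmf)
  let ?f = "\<lambda>T. if T \<in> plane_trees n then tree_weight w T / partition_function w n else 0"
  note pos = partition_function_pos[OF assms]
  show nonneg: "0 \<le> ?f T" for T
    using pos tree_weight_nonneg[OF assms(1)] by simp
  have "(\<integral>\<^sup>+ T. ennreal (?f T) \<partial>count_space UNIV) = (\<Sum>T\<in>plane_trees n. ennreal (?f T))"
    by (intro nn_integral_count_space') (auto simp: finite_plane_trees)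
  also have "\<dots> = ennreal (\<Sum>T\<in>plane_trees n. ?f T)"
    by (intro sum_ennreal nonneg)
  also have "(\<Sum>T\<in>plane_trees n. ?f T) = 1"
    using pos by (simp add: partition_function_def flip: sum_divide_distrib)
  finally show "(\<integral>\<^sup>+ T. ennreal (?f T) \<partial>count_space UNIV) = 1"
    by simp
qed

section \<open>Types of weight sequences\<close>

text \<open>
  \<open>gen_fun w z\<close> is the generating function \<open>\<Phi>(z)\<close>, with values in \<open>[0, \<infinity>]\<close>. Its derivative is the
  termwise one, \<open>gen_fun (diffs w) z\<close>, which makes sense also at the radius of convergence (where
  it is the left derivative, possibly infinite, if \<open>\<Phi>\<close> is finite there).
\<close>

definition gen_fun :: "(nat \<Rightarrow> real) \<Rightarrow> ennreal \<Rightarrow> ennreal" where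
  "gen_fun w z = (\<Sum>k. ennreal (w k) * z ^ k)"

definition radius :: "(nat \<Rightarrow> real) \<Rightarrow> ennreal" where
  "radius w = e2ennreal (conv_radius w)"

definition type_I :: "(nat \<Rightarrow> real) \<Rightarrow> bool" where
  "type_I w \<longleftrightarrow> (\<exists>\<tau>. 0 < \<tau> \<and> \<tau> < \<infinity> \<and> \<tau> \<le> radius w \<and> gen_fun w \<tau> < \<infinity> \<and>
     \<tau> * gen_fun (diffs w) \<tau> / gen_fun w \<tau> = 1)"

text \<open>
  An infinite radius is excluded by the finiteness of \<open>gen_fun w\<close> there, as some \<open>w k\<close>
  with \<open>k \<ge> 2\<close> is positive.
\<close>

definition type_II :: "(nat \<Rightarrow> real) \<Rightarrow> bool" where
  "type_II w \<longleftrightarrow> 0 < radius w \<and> gen_fun w (radius w) < \<infinity> \<and>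
     radius w * gen_fun (diffs w) (radius w) / gen_fun w (radius w) < 1"

definition type_III :: "(nat \<Rightarrow> real) \<Rightarrow> bool" where
  "type_III w \<longleftrightarrow> radius w = 0"

section \<open>Moments and uniform integrability\<close>

text \<open>The power \<open>x\<^sup>p\<close> for real \<open>x, p \<ge> 0\<close> with \<open>0\<^sup>0 = 1\<close>, whereas \<open>0 powr 0 = 0\<close>.\<close>

definition nonneg_power :: "real \<Rightarrow> real \<Rightarrow> real" where
  "nonneg_power x p = (if p = 0 then 1 else x powr p)"

text \<open>The random variables \<open>X i\<close> may live on different probability spaces \<open>M i\<close>.\<close>

definition uniformly_integrable ::
    "'i set \<Rightarrow> ('i \<Rightarrow> 'a measure) \<Rightarrow> ('i \<Rightarrow> 'a \<Rightarrow> real) \<Rightarrow> bool" where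
  "uniformly_integrable I M X \<longleftrightarrow>
     (\<forall>i\<in>I. X i \<in> borel_measurable (M i)) \<and>
     ((\<lambda>K::real. SUP i\<in>I. \<integral>\<^sup>+ x. ennreal \<bar>X i x\<bar> * indicator {x. K < \<bar>X i x\<bar>} x \<partial>M i)
        \<longlongrightarrow> 0) at_top"

end

theory Submission
  imports Defs "HOL-Real_Asymp.Real_Asymp"
begin

text \<open>
  Read the outdegrees of \<open>T\<close> in depth-first order, starting at \<open>v\<close> and continuing cyclically. By
  the cycle lemma this is a weight-preserving bijection from pairs \<open>(T, v)\<close> with \<open>n\<close> vertices onto
  the words of length \<open>n\<close> and sum \<open>n - 1\<close>, whose weight is invariant under permutations of the
  letters. If the border distance of \<open>v\<close> is at least \<open>k\<close>, then so is the length of the leftmost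
  path from \<open>v\<close> to a leaf, and the first \<open>k\<close> letters are nonzero. By exchangeability, among words
  with at least \<open>c n\<close> zeros this has probability at most \<open>(1 - c)\<^sup>k\<close>. Words with fewer zeros consist
  mostly of ones; turning a block of \<open>K\<close> ones into a letter \<open>K\<close> and \<open>K - 1\<close> zeros shows that their
  probability is exponentially small in \<open>n\<close>. Hence the border distance has a geometric tail, uniform
  in \<open>n\<close>, whatever the type of the weight sequence.
\<close>

section \<open>Depth-first words\<close>

fun dfs_word :: "plane_tree \<Rightarrow> nat list" where
  "dfs_word (Node ts) = length ts # concat (map dfs_word ts)"

text \<open>End value of the Lukasiewicz walk with steps \<open>d - 1\<close>, where
  \<open>d\<close> runs through the letters. It is an integer because the walk of a tree ends at
  -1.\<close>

definition height :: "nat list \<Rightarrow> int" where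
  "height x = int (sum_list x) - int (length x)"

lemma height_simps [simp]:
  "height [] = 0" "height (d # x) = int d - 1 + height x" "height (x @ y) = height x + height y"
  by (auto simp: height_def)

lemma dfs_word_not_Nil [simp]: "dfs_word T \<noteq> []"
  by (cases T) simp

lemma height_dfs_word [simp]: "height (dfs_word T) = -1"
proof (induction T)
  case (Node ts)
  then have "height (concat (map dfs_word ts)) = - int (length ts)"
    by (induction ts) auto
  then show ?case by simp
qed

text \<open>After reading a prefix, height plus one is the number of subtrees still to be read, so
  the walk first reaches -1 with the last letter.\<close>

lemma height_prefix_dfs_word: "dfs_word T = a @ b \<Longrightarrow> b \<noteq> [] \<Longrightarrow> 0 \<le> height a"
proof (induction T arbitrary: a b)
  case (Node ts)
  \<comment> \<open>The induction over the children needs the forest version: a forest of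
    \<open>m\<close> trees reaches height \<open>- m\<close> only at its very end.\<close>
  have *: "- int (length ts) < height a"
    if "concat (map dfs_word ts) = a @ b" "b \<noteq> []" for a b
    using Node.IH that
  proof (induction ts arbitrary: a)
    case (Cons t ts)
    from Cons.prems(2) have "dfs_word t @ concat (map dfs_word ts) = a @ b" by simp
    then consider c where "dfs_word t = a @ c" "c \<noteq> []"
      | c where "a = dfs_word t @ c" "concat (map dfs_word ts) = c @ b"
      by (cases "length a < length (dfs_word t)") (auto simp: append_eq_append_conv2)
    then show ?case
    proof cases
      case 1
      then have "0 \<le> height a" using Cons.prems(1) by (meson list.set_intros(1))
      then show ?thesis by simp
    next
      case 2
      then have "- int (length ts) < height c" using Cons by auto
      then show ?thesis using 2 by simp
    qed
  qed simp
  show ?case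
  proof (cases a)
    case (Cons d a')
    then show ?thesis using Node.prems *[of a' b] by auto
  qed simp
qed

text \<open>Each letter tells how many subtrees follow, so decoding is deterministic and knows where
  it stops. The arbitrary suffixes \<open>a\<close> and \<open>b\<close> let the induction pass from
  one sibling to the next.\<close>

lemma dfs_word_prefix_free: "dfs_word t @ a = dfs_word t' @ b \<Longrightarrow> t = t' \<and> a = b"
proof (induction t arbitrary: t' a b)
  case (Node ts)
  obtain ts' where t': "t' = Node ts'" by (cases t')
  have "ts = ts' \<and> a = b"
    if "concat (map dfs_word ts) @ a = concat (map dfs_word ts') @ b" "length ts = length ts'"
    using Node.IH that
  proof (induction ts arbitrary: ts')
    case (Cons t ts)
    then obtain s ss where ts': "ts' = s # ss" by (cases ts') auto
    with Cons.prems have "dfs_word t @ concat (map dfs_word ts) @ a = dfs_word s @ concat (map dfs_word ss) @ b"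
      by simp
    then have "t = s \<and> concat (map dfs_word ts) @ a = concat (map dfs_word ss) @ b"
      by (rule Cons.prems(1)[OF list.set_intros(1)])
    moreover from this have "ts = ss \<and> a = b"
    proof (intro Cons.IH)
      show "x = t' \<and> a = b" if "x \<in> set ts" "dfs_word x @ a = dfs_word t' @ b" for x t' a b
        using Cons.prems(1)[OF _ that(2)] that(1) by simp
    qed (use Cons.prems ts' in auto)
    ultimately show ?case using ts' by simp
  qed simp
  then show ?case using Node.prems t' by simp
qed

lemma inj_dfs_word: "inj dfs_word"
  using dfs_word_prefix_free[of _ "[]" _ "[]"] by (auto intro: injI)

text \<open>Decoding: reading a letter \<open>d\<close> replaces the first of \<open>m\<close>
  pending trees by its \<open>d\<close> subtrees, leaving \<open>m + d - 1\<close> trees. The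
  hypothesis on prefixes survives this shift.\<close>

lemma ex_forest_dfs_word:
  assumes "height x = - int m" "\<And>a b. x = a @ b \<Longrightarrow> b \<noteq> [] \<Longrightarrow> - int m < height a"
  shows "\<exists>ts. length ts = m \<and> x = concat (map dfs_word ts)"
  using assms
proof (induction x arbitrary: m)
  case (Cons d x)
  have m: "0 < m" using Cons.prems(2)[of "[]" "d # x"] by simp
  have "\<exists>ts. length ts = m + d - 1 \<and> x = concat (map dfs_word ts)"
  proof (rule Cons.IH)
    show "height x = - int (m + d - 1)" using Cons.prems(1) m by (simp add: of_nat_diff)
    fix a b assume "x = a @ b" "b \<noteq> []"
    then show "- int (m + d - 1) < height a"
      using Cons.prems(2)[of "d # a" b] m by (simp add: of_nat_diff)
  qed
  then obtain ts where ts: "length ts = m + d - 1" "x = concat (map dfs_word ts)" by blast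
  \<comment> \<open>The first \<open>d\<close> decoded trees are the children of the root that
    carries the letter \<open>d\<close>.\<close>
  have "x = concat (map dfs_word (take d ts)) @ concat (map dfs_word (drop d ts))"
    unfolding ts by (simp flip: concat_append map_append)
  then show ?case
    using ts m by (intro exI[of _ "Node (take d ts) # drop d ts"]) auto
qed auto

lemma ex_dfs_word:
  assumes "height x = -1" "\<And>a b. x = a @ b \<Longrightarrow> b \<noteq> [] \<Longrightarrow> 0 \<le> height a"
  shows "\<exists>T. x = dfs_word T"
proof -
  have "\<exists>ts. length ts = 1 \<and> x = concat (map dfs_word ts)"
    using assms(2) by (intro ex_forest_dfs_word) (fastforce simp: assms(1))+
  then show ?thesis by (auto simp: length_Suc_conv)
qed

section \<open>Size and weight of a tree read off its word\<close>

lemma card_vertices: "card (vertices T) = length (dfs_word T)"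
proof (induction T)
  case (Node ts)
  have "card (vertices (Node ts)) = Suc (\<Sum>i<length ts. card (vertices (ts ! i)))"
    unfolding vertices_Node
    by (subst card_insert_disjoint)
      (auto simp: finite_vertices card_image intro!: card_UN_disjoint[THEN trans])
  also have "\<dots> = length (dfs_word (Node ts))"
    using Node by (simp add: length_concat o_def sum_list_sum_nth atLeast0LessThan)
  finally show ?case .
qed

lemma tree_weight_dfs_word: "tree_weight w T = prod_list (map w (dfs_word T))"
proof (induction T)
  case (Node ts)
  have "tree_weight w (Node ts) = w (length ts) *
      (\<Prod>v\<in>(\<Union>i<length ts. (#) i ` vertices (ts ! i)). w (outdegree (Node ts) v))"
    unfolding tree_weight_def vertices_Node
    by (subst prod.insert) (auto simp: finite_vertices outdegree_def)
  also have "(\<Prod>v\<in>(\<Union>i<length ts. (#) i ` vertices (ts ! i)). w (outdegree (Node ts) v)) =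
      (\<Prod>i<length ts. tree_weight w (ts ! i))"
    by (subst prod.UNION_disjoint)
      (auto simp: finite_vertices prod.reindex tree_weight_def outdegree_def)
  also have "\<dots> = prod_list (map (\<lambda>t. prod_list (map w (dfs_word t))) ts)"
    using Node by (simp add: prod.list_conv_set_nth atLeast0LessThan)
  also have "\<dots> = prod_list (map w (concat (map dfs_word ts)))"
    by (induction ts) auto
  finally show ?case by simp
qed

section \<open>Cutting the depth-first word at a vertex\<close>

fun dfs_before :: "plane_tree \<Rightarrow> vertex \<Rightarrow> nat list" where
  "dfs_before T [] = []"
| "dfs_before (Node ts) (i # u) =
     length ts # concat (map dfs_word (take i ts)) @ dfs_before (ts ! i) u"

text \<open>The cut is made just before the letter of the vertex itself, so this part is never empty
  for an actual vertex, and it begins with the word of the subtree there.\<close>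

fun dfs_after :: "plane_tree \<Rightarrow> vertex \<Rightarrow> nat list" where
  "dfs_after T [] = dfs_word T"
| "dfs_after (Node ts) (i # u) =
     dfs_after (ts ! i) u @ concat (map dfs_word (drop (Suc i) ts))"

lemma dfs_word_split: "is_vertex T v \<Longrightarrow> dfs_before T v @ dfs_after T v = dfs_word T"
proof (induction T v rule: dfs_before.induct)
  case (2 ts i u)
  then have IH: "dfs_before (ts ! i) u @ dfs_after (ts ! i) u = dfs_word (ts ! i)" and i: "i < length ts"
    by simp_all
  have "dfs_before (Node ts) (i # u) @ dfs_after (Node ts) (i # u) =
      length ts # concat (map dfs_word (take i ts)) @
        (dfs_before (ts ! i) u @ dfs_after (ts ! i) u) @ concat (map dfs_word (drop (Suc i) ts))"
    by simp
  also have "\<dots> = length ts # concat (map dfs_word (take i ts @ ts ! i # drop (Suc i) ts))"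
    unfolding IH by simp
  finally show ?case using i by (simp flip: id_take_nth_drop)
qed simp

lemma dfs_after_subtree: "is_vertex T v \<Longrightarrow> \<exists>c. dfs_after T v = dfs_word (subtree_at T v) @ c"
  by (induction T v rule: dfs_before.induct) force+

lemma dfs_after_not_Nil [simp]: "is_vertex T v \<Longrightarrow> dfs_after T v \<noteq> []"
  using dfs_after_subtree[of T v] by auto

lemma length_dfs_before_less:
  assumes "is_vertex T v" shows "length (dfs_before T v) < length (dfs_word T)"
  using dfs_after_not_Nil[OF assms] by (simp flip: dfs_word_split[OF assms])

lemma dfs_before_inj:
  "\<lbrakk>is_vertex T u; is_vertex T v; length (dfs_before T u) = length (dfs_before T v)\<rbrakk> \<Longrightarrow> u = v"
proof (induction T u arbitrary: v rule: dfs_before.induct)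
  case (1 T)
  then show ?case by (cases T; cases v) auto
next
  case (2 ts i u)
  then obtain j v' where v: "v = j # v'" by (cases v) auto
  \<comment> \<open>\<open>pos k\<close> is the offset, not counting the letter of the root, at
    which the block of child \<open>k\<close> starts. Blocks of different children are disjoint, so
    a position determines the child.\<close>
  define pos where "pos k = length (concat (map dfs_word (take k ts)))" for k
  have pos_less: "pos a + length (dfs_before (ts ! a) x) < pos b"
    if "a < b" "b < length ts" "is_vertex (ts ! a) x" for a b x
  proof -
    have "pos a + length (dfs_before (ts ! a) x) < pos (Suc a)"
      using that length_dfs_before_less[of "ts ! a" x] by (simp add: pos_def take_Suc_conv_app_nth)
    also have "pos (Suc a) \<le> pos b"
    proof -
      have "take b ts = take (Suc a) ts @ drop (Suc a) (take b ts)"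
        using append_take_drop_id[of "Suc a" "take b ts"] that by (simp add: min_def)
      then have "map dfs_word (take b ts) =
          map dfs_word (take (Suc a) ts) @ map dfs_word (drop (Suc a) (take b ts))"
        by (metis map_append)
      then show ?thesis by (simp add: pos_def)
    qed
    finally show ?thesis .
  qed
  have eq: "pos i + length (dfs_before (ts ! i) u) = pos j + length (dfs_before (ts ! j) v')"
    using 2 v by (simp add: pos_def)
  have "i = j"
    using pos_less[of i j u] pos_less[of j i v'] eq 2 v by (cases i j rule: linorder_cases) auto
  then show ?case using 2 v eq by auto
qed

lemma bij_betw_length_dfs_before:
  "bij_betw (\<lambda>v. length (dfs_before T v)) (vertices T) {..<length (dfs_word T)}"
proof -
  have inj: "inj_on (\<lambda>v. length (dfs_before T v)) (vertices T)"
    by (auto intro!: inj_onI dfs_before_inj simp: vertices_def)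
  have "(\<lambda>v. length (dfs_before T v)) ` vertices T = {..<length (dfs_word T)}"
    by (rule card_subset_eq)
      (auto simp: card_image[OF inj] card_vertices length_dfs_before_less
        dest: vertices_def[THEN eq_refl, THEN subsetD])
  with inj show ?thesis by (simp add: bij_betw_def)
qed

section \<open>The cycle lemma\<close>

text \<open>Writing the sum condition with \<open>Suc\<close> avoids truncated subtraction and makes
  \<open>words 0\<close> empty.\<close>

definition words :: "nat \<Rightarrow> nat list set" where
  "words n = {x. length x = n \<and> Suc (sum_list x) = n}"

lemma words_iff_height: "x \<in> words n \<longleftrightarrow> length x = n \<and> height x = -1"
  by (auto simp: words_def height_def)

lemma finite_words: "finite (words n)"
proof (rule finite_subset)
  show "words n \<subseteq> {x. set x \<subseteq> {..n} \<and> length x = n}"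
    by (auto simp: words_def dest: member_le_sum_list)
qed (simp add: finite_lists_length_eq)

definition rotated_word :: "plane_tree \<times> vertex \<Rightarrow> nat list" where
  "rotated_word = (\<lambda>(T, v). dfs_after T v @ dfs_before T v)"

definition vertex_trees :: "nat \<Rightarrow> (plane_tree \<times> vertex) set" where
  "vertex_trees n = Sigma (plane_trees n) vertices"

lemma vertex_trees_iff:
  "(T, v) \<in> vertex_trees n \<longleftrightarrow> length (dfs_word T) = n \<and> is_vertex T v"
  unfolding vertex_trees_def plane_trees_def mem_Sigma_iff mem_Collect_eq card_vertices
  by (simp add: vertices_def)

text \<open>If two different cuts of one cyclic word both gave trees, the two arcs between the cuts
  would be proper prefixes of tree words. Both would have nonnegative height, yet their heights add
  up to -1.\<close>

lemma rotation_unique_aux: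
  assumes "dfs_word T = b @ a" "dfs_word T' = b' @ a'" "a @ b = a' @ b'" "a \<noteq> []"
    "length a \<le> length a'"
  shows "a = a'"
proof -
  obtain c where c: "a' = a @ c" "b = c @ b'"
    using assms(3,5) by (auto simp: append_eq_append_conv2)
  have "c = []"
  proof (rule ccontr)
    assume "c \<noteq> []"
    have "0 \<le> height c" using height_prefix_dfs_word[of T c "b' @ a"] assms c by simp
    moreover have "0 \<le> height (b' @ a)"
      using height_prefix_dfs_word[of T' "b' @ a" c] assms c \<open>c \<noteq> []\<close> by simp
    moreover have "height c + height (b' @ a) = -1"
      using height_dfs_word[of T] assms c by simp
    ultimately show False by simp
  qed
  then show ?thesis using c by simp
qed

lemma inj_on_rotated_word: "inj_on rotated_word (vertex_trees n)"
proof (rule inj_onI, clarify)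
  fix T v T' v'
  assume V: "(T, v) \<in> vertex_trees n" "(T', v') \<in> vertex_trees n"
    and eq: "rotated_word (T, v) = rotated_word (T', v')"
  have sp: "dfs_word T = dfs_before T v @ dfs_after T v" "dfs_word T' = dfs_before T' v' @ dfs_after T' v'"
    and nz: "dfs_after T v \<noteq> []" "dfs_after T' v' \<noteq> []"
    using V by (simp_all add: vertex_trees_iff dfs_word_split)
  have e: "dfs_after T v @ dfs_before T v = dfs_after T' v' @ dfs_before T' v'"
    using eq by (simp add: rotated_word_def)
  have a: "dfs_after T v = dfs_after T' v'"
    using rotation_unique_aux[OF sp e nz(1)] rotation_unique_aux[OF sp(2,1) e[symmetric] nz(2)]
    by (metis nle_le)
  with e have b: "dfs_before T v = dfs_before T' v'" by simp
  have "T = T'" using a b sp inj_dfs_word by (metis injD)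
  then show "T = T' \<and> v = v'"
    using b V dfs_before_inj[of T v v'] by (simp add: vertex_trees_iff)
qed

text \<open>Cutting at the first time \<open>j\<close> at which the walk attains its minimum
  \<open>m\<close> over proper prefixes gives a tree. Before the wrap-around the rotated walk stays
  at or above 0 because \<open>m\<close> is minimal; after it, because earlier values exceed
  \<open>m\<close> strictly.\<close>

lemma cycle_lemma:
  assumes "height x = -1"
  obtains a b T where "x = a @ b" "a \<noteq> []" "dfs_word T = b @ a"
proof -
  have "x \<noteq> []" using assms by auto
  define S where "S i = height (take i x)" for i
  define m where "m = Min (S ` {..<length x})"
  have m_le: "m \<le> S i" if "i < length x" for i
    using that by (simp add: m_def)
  have "m \<in> S ` {..<length x}"
    unfolding m_def using \<open>x \<noteq> []\<close> by (intro Min_in) auto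
  then have ex: "\<exists>j. j < length x \<and> S j = m" by auto
  define j where "j = (LEAST j. j < length x \<and> S j = m)"
  have j: "j < length x" "S j = m" using LeastI_ex[OF ex] by (auto simp: j_def)
  have before: "m < S i" if "i < j" for i
  proof -
    have "i < length x" using that j by simp
    then have "S i \<noteq> m" using not_less_Least[of i "\<lambda>j. j < length x \<and> S j = m"] that
      by (auto simp: j_def)
    then show ?thesis using m_le[OF \<open>i < length x\<close>] by simp
  qed
  have tot: "height (take j x) + height (drop j x) = -1"
    using assms by (metis append_take_drop_id height_simps(3))
  have "\<exists>T. drop j x @ take j x = dfs_word T"
  proof (rule ex_dfs_word)
    show "height (drop j x @ take j x) = -1" using tot by simp
    fix a b assume ab: "drop j x @ take j x = a @ b" "b \<noteq> []"
    then obtain us where us: "drop j x = a @ us \<and> us @ take j x = b \<or> drop j x @ us = a \<and> take j x = us @ b"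
      unfolding append_eq_append_conv2 by blast
    \<comment> \<open>A prefix that ends exactly at the wrap-around goes to the second case with
      \<open>c = []\<close>, since \<open>m\<close> does not bound the height of the whole
      word.\<close>
    consider (1) c where "drop j x = a @ c" "c \<noteq> []"
      | (2) c where "a = drop j x @ c" "take j x = c @ b"
    proof (cases "us = []")
      case True
      then show ?thesis using us that(2)[of "[]"] by auto
    next
      case False
      then show ?thesis using us that by blast
    qed
    then show "0 \<le> height a"
    proof cases
      case 1
      have "length a < length x - j" using arg_cong[OF 1(1), of length] 1(2) by (cases c) auto
      then have "j + length a < length x" by simp
      have "take (j + length a) x = take j x @ a"
        using 1 by (simp add: take_add)
      then have "S (j + length a) = m + height a" using j(2) by (simp add: S_def)
      then show ?thesis using m_le[OF \<open>j + length a < length x\<close>] by simp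
    next
      case 2
      have "length c < j"
        using arg_cong[OF 2(2), of length] j ab(2) by simp
      have "take (length c) x = c"
        using arg_cong[OF 2(2), of "take (length c)"] \<open>length c < j\<close> by (simp add: min_def)
      then have "m < height c" using before[OF \<open>length c < j\<close>] by (simp add: S_def)
      then show ?thesis using 2(1) tot j(2) by (simp add: S_def)
    qed
  qed
  then obtain T where "drop j x @ take j x = dfs_word T" by blast
  then have T: "dfs_word T = drop j x @ take j x" ..
  show ?thesis
  \<comment> \<open>As \<open>a\<close> must be nonempty, the trivial rotation is written with
    \<open>a = x\<close> and \<open>b = []\<close>.\<close>
  proof (cases "j = 0")
    case True
    then show ?thesis using that[of x "[]" T] \<open>x \<noteq> []\<close> T by simp
  next
    case False
    then show ?thesis using that[of "take j x" "drop j x" T] \<open>x \<noteq> []\<close> T by simp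
  qed
qed

lemma bij_betw_rotated_word: "bij_betw rotated_word (vertex_trees n) (words n)"
proof -
  have "rotated_word z \<in> words n" if "z \<in> vertex_trees n" for z
  proof (cases z)
    case (Pair T v)
    then have "dfs_word T = dfs_before T v @ dfs_after T v" "length (dfs_word T) = n"
      using that by (simp_all add: vertex_trees_iff dfs_word_split)
    then show ?thesis
      using height_dfs_word[of T] by (simp add: Pair rotated_word_def words_iff_height)
  qed
  moreover have "x \<in> rotated_word ` vertex_trees n" if "x \<in> words n" for x
  proof -
    have x: "height x = -1" "length x = n" using that by (auto simp: words_iff_height)
    obtain a b T where abT: "x = a @ b" "a \<noteq> []" "dfs_word T = b @ a"
      using cycle_lemma[OF x(1)] .
    \<comment> \<open>The marked vertex is the one whose position in the depth-first word is the
      cutting point.\<close>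
    have "length b \<in> {..<length (dfs_word T)}" using abT by simp
    then obtain v where v: "is_vertex T v" "length (dfs_before T v) = length b"
      unfolding bij_betw_imp_surj_on[OF bij_betw_length_dfs_before, symmetric]
      by (auto simp: vertices_def)
    have "dfs_before T v = b \<and> dfs_after T v = a"
      using dfs_word_split[OF v(1)] v(2) abT(3) by simp
    moreover have "(T, v) \<in> vertex_trees n"
      using abT x v by (simp add: vertex_trees_iff)
    ultimately show ?thesis
      using abT by (force simp: rotated_word_def)
  qed
  ultimately show ?thesis
    using inj_on_rotated_word[of n] by (auto simp: bij_betw_def)
qed

section \<open>Border distance and the leftmost path\<close>

fun left_depth :: "plane_tree \<Rightarrow> nat" where
  "left_depth (Node []) = 0"
| "left_depth (Node (t # ts)) = Suc (left_depth t)"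

text \<open>A first child is visited immediately after its parent, so the leftmost path fills the
  initial letters, and every vertex on it before the final leaf has a child.\<close>

lemma dfs_word_left_depth:
  "i < left_depth T \<Longrightarrow> i < length (dfs_word T) \<and> dfs_word T ! i \<noteq> 0"
proof (induction T arbitrary: i rule: left_depth.induct)
  case (2 t ts)
  then show ?case by (cases i) (auto simp: nth_append intro: trans_less_add1)
qed simp

lemma is_vertex_append: "is_vertex T (u @ v) \<longleftrightarrow> is_vertex T u \<and> is_vertex (subtree_at T u) v"
  by (induction T u rule: is_vertex.induct) auto

lemma subtree_at_append: "subtree_at T (u @ v) = subtree_at (subtree_at T u) v"
  by (induction T u rule: subtree_at.induct) auto

lemma left_path:
  "is_vertex T (replicate (left_depth T) 0)"
  "children (subtree_at T (replicate (left_depth T) 0)) = []"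
  by (induction T rule: left_depth.induct) auto

text \<open>The minimum over all leaves is bounded by the distance to one of them, here the leaf
  ending the leftmost path below \<open>v\<close>.\<close>

lemma border_dist_le_left_depth:
  assumes "is_vertex T v"
  shows "border_dist T v \<le> left_depth (subtree_at T v)"
proof -
  define d where "d = left_depth (subtree_at T v)"
  define l where "l = v @ replicate d 0"
  have "l \<in> leaves T"
    using assms left_path[of "subtree_at T v"]
    by (simp add: leaves_def l_def d_def vertices_def outdegree_def is_vertex_append subtree_at_append)
  have path: "(v, v @ replicate k 0) \<in> tree_edges T ^^ k" if "k \<le> d" for k
    using that
  proof (induction k)
    case (Suc k)
    have V: "v @ replicate j 0 \<in> vertices T" if "j \<le> d" for j
    proof -
      have "l = (v @ replicate j 0) @ replicate (d - j) 0"
        using that by (simp add: l_def flip: replicate_add)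
      then show ?thesis
        using \<open>l \<in> leaves T\<close> is_vertex_append[of T "v @ replicate j 0" "replicate (d - j) 0"]
        by (simp add: leaves_def vertices_def)
    qed
    have "(v @ replicate k 0, v @ replicate (Suc k) 0) \<in> tree_edges T"
      using V[of k] V[of "Suc k"] Suc.prems by (simp add: tree_edges_def flip: replicate_append_same)
    then show ?case using Suc by auto
  qed simp
  have "tree_dist T v l \<le> d"
    unfolding tree_dist_def l_def by (rule Least_le) (rule path, simp)
  moreover have "border_dist T v \<le> tree_dist T v l"
    unfolding border_dist_def using \<open>l \<in> leaves T\<close>
    by (intro Min_le) (auto simp: leaves_def finite_vertices)
  ultimately show ?thesis by (simp add: d_def)
qed

lemma rotated_word_border_dist:
  assumes "is_vertex T v" "i < border_dist T v"
  shows "i < length (rotated_word (T, v)) \<and> rotated_word (T, v) ! i \<noteq> 0"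
proof -
  obtain c where "dfs_after T v = dfs_word (subtree_at T v) @ c"
    using dfs_after_subtree[OF assms(1)] by blast
  moreover have "i < left_depth (subtree_at T v)"
    using border_dist_le_left_depth[OF assms(1)] assms(2) by simp
  ultimately show ?thesis
    using dfs_word_left_depth[of i "subtree_at T v"] by (auto simp: rotated_word_def nth_append)
qed

section \<open>Exchangeable words\<close>

text \<open>An unnormalised probability: quotients by \<open>mass w (words n)\<close> give the law
  of the random word.\<close>

definition mass :: "(nat \<Rightarrow> real) \<Rightarrow> nat list set \<Rightarrow> real" where
  "mass w A = (\<Sum>x\<in>A. prod_list (map w x))"

lemma prod_list_map_nonneg: "(\<And>k. 0 \<le> w k) \<Longrightarrow> 0 \<le> prod_list (map w x)" for w :: "nat \<Rightarrow> real"
  by (induction x) auto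

lemma mass_mono: "(\<And>k. 0 \<le> w k) \<Longrightarrow> finite B \<Longrightarrow> A \<subseteq> B \<Longrightarrow> mass w A \<le> mass w B"
  unfolding mass_def by (intro sum_mono2) (auto simp: prod_list_map_nonneg)

lemma mass_nonneg: "(\<And>k. 0 \<le> w k) \<Longrightarrow> 0 \<le> mass w A"
  unfolding mass_def by (intro sum_nonneg) (auto simp: prod_list_map_nonneg)

lemma mass_Un_le:
  assumes "\<And>k. 0 \<le> w k" "finite A" "finite B"
  shows "mass w (A \<union> B) \<le> mass w A + mass w B"
proof -
  have "mass w (A \<union> B) + mass w (A \<inter> B) = mass w A + mass w B"
    unfolding mass_def using assms(2,3) by (rule sum.union_inter)
  then show ?thesis using mass_nonneg[of w "A \<inter> B", OF assms(1)] by simp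
qed

lemma mass_UN_le:
  assumes "\<And>k. 0 \<le> w k" "finite I" "\<And>i. i \<in> I \<Longrightarrow> finite (A i)"
  shows "mass w (\<Union>i\<in>I. A i) \<le> (\<Sum>i\<in>I. mass w (A i))"
  using assms(2,3)
proof (induction I rule: finite_induct)
  case (insert i I)
  have "mass w (A i \<union> (\<Union>i\<in>I. A i)) \<le> mass w (A i) + mass w (\<Union>i\<in>I. A i)"
    using insert by (intro mass_Un_le assms(1)) auto
  then show ?case using insert by simp
qed (simp add: mass_def)

section \<open>Exchangeability and the many-zeros regime\<close>

definition swap_nth :: "nat \<Rightarrow> nat \<Rightarrow> 'a list \<Rightarrow> 'a list" where
  "swap_nth i j x = x[i := x ! j, j := x ! i]"

lemma swap_nth_simps [simp]:
  "length (swap_nth i j x) = length x"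
  "i < length x \<Longrightarrow> j < length x \<Longrightarrow> mset (swap_nth i j x) = mset x"
  "i < length x \<Longrightarrow> j < length x \<Longrightarrow> swap_nth i j x ! i = x ! j"
  "i < length x \<Longrightarrow> j < length x \<Longrightarrow> swap_nth i j x ! j = x ! i"
  "l \<noteq> i \<Longrightarrow> l \<noteq> j \<Longrightarrow> swap_nth i j x ! l = x ! l"
  "i < length x \<Longrightarrow> j < length x \<Longrightarrow> swap_nth i j (swap_nth i j x) = x"
  by (auto simp: swap_nth_def mset_swap nth_list_update intro: nth_equalityI)

text \<open>Swapping letters preserves weight, so all positions from \<open>k\<close> on satisfy
  \<open>P\<close> with equal mass; summing over them and exchanging sums counts positions. Leaving
  the first \<open>k\<close> positions alone allows conditioning on them.\<close>

lemma mass_nth_swap_invariant: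
  assumes A: "finite A" "\<And>x. x \<in> A \<Longrightarrow> length x = n"
    and swap: "\<And>x i j. x \<in> A \<Longrightarrow> i \<in> {k..<n} \<Longrightarrow> j \<in> {k..<n} \<Longrightarrow> swap_nth i j x \<in> A"
    and i: "i \<in> {k..<n}"
  shows "real (n - k) * mass w {x\<in>A. P (x ! i)} =
    (\<Sum>x\<in>A. real (card {j\<in>{k..<n}. P (x ! j)}) * prod_list (map w x))"
proof -
  have "mass w {x\<in>A. P (x ! j)} = mass w {x\<in>A. P (x ! i)}" if j: "j \<in> {k..<n}" for j
    unfolding mass_def
  proof (rule sum.reindex_bij_witness[where i = "swap_nth i j" and j = "swap_nth i j"])
    fix x assume x: "x \<in> {x\<in>A. P (x ! j)}"
    then have n: "length x = n" using A by auto
    then show "swap_nth i j (swap_nth i j x) = x" "swap_nth i j x \<in> {x\<in>A. P (x ! i)}"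
      using x i j swap by auto
    show "prod_list (map w (swap_nth i j x)) = prod_list (map w x)"
      using i j n by (simp flip: prod_mset_prod_list)
  next
    fix x assume x: "x \<in> {x\<in>A. P (x ! i)}"
    then have n: "length x = n" using A by auto
    then show "swap_nth i j (swap_nth i j x) = x" "swap_nth i j x \<in> {x\<in>A. P (x ! j)}"
      using x i j swap by auto
  qed
  then have "real (n - k) * mass w {x\<in>A. P (x ! i)} = (\<Sum>j\<in>{k..<n}. mass w {x\<in>A. P (x ! j)})"
    by simp
  also have "\<dots> = (\<Sum>j\<in>{k..<n}. \<Sum>x\<in>A. if P (x ! j) then prod_list (map w x) else 0)"
    unfolding mass_def using A(1) by (simp add: sum.inter_filter)
  also have "\<dots> = (\<Sum>x\<in>A. \<Sum>j\<in>{k..<n}. if P (x ! j) then prod_list (map w x) else 0)"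
    by (rule sum.swap)
  also have "\<dots> = (\<Sum>x\<in>A. real (card {j\<in>{k..<n}. P (x ! j)}) * prod_list (map w x))"
    by (simp flip: sum.inter_filter)
  finally show ?thesis .
qed

lemma count_eq_card: "count_list x a = card {j. j < length x \<and> x ! j = a}"
  by (simp add: count_list_eq_length_filter length_filter_conv_card eq_commute)

lemma words_swap:
  assumes "x \<in> words n" "i < n" "j < n"
  shows "swap_nth i j x \<in> words n" "count_list (swap_nth i j x) a = count_list x a"
proof -
  have m: "mset (swap_nth i j x) = mset x" using assms by (simp add: words_def)
  then have "sum_list (swap_nth i j x) = sum_list x" by (metis sum_mset_sum_list)
  then show "swap_nth i j x \<in> words n" using assms by (simp add: words_def)
  show "count_list (swap_nth i j x) a = count_list x a" using m by (simp flip: count_mset)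
qed

text \<open>Sampling without replacement: if the first \<open>k\<close> letters are nonzero, all
  zeros lie among the other \<open>n - k\<close> positions, so the next letter is zero with
  conditional probability at least \<open>c\<close>.\<close>

lemma mass_nonzero_prefix_le:
  fixes c :: real
  assumes w: "\<And>k. 0 \<le> w k" and c: "c \<le> 1" and k: "k \<le> n"
  shows "mass w {x\<in>words n. c * n \<le> count_list x 0 \<and> (\<forall>i<k. x ! i \<noteq> 0)} \<le> (1 - c) ^ k * mass w (words n)"
  using k
proof (induction k)
  case 0
  then show ?case by (auto intro: mass_mono w finite_words)
next
  case (Suc k)
  define A where "A = {x\<in>words n. c * n \<le> count_list x 0 \<and> (\<forall>i<k. x ! i \<noteq> 0)}"
  have fin: "finite A" by (simp add: A_def finite_words)
  have len: "length x = n" if "x \<in> A" for x using that by (simp add: A_def words_def)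
  have n: "0 < n" "k < n" using Suc.prems by auto
  have swapA: "swap_nth i j x \<in> A" if "x \<in> A" "i \<in> {k..<n}" "j \<in> {k..<n}" for x i j
    using that words_swap[of x n i j] by (auto simp: A_def)
  have "real n * (c * mass w A) = (\<Sum>x\<in>A. c * n * prod_list (map w x))"
    by (simp add: mass_def sum_distrib_left mult_ac)
  also have "\<dots> \<le> (\<Sum>x\<in>A. real (card {j\<in>{k..<n}. x ! j = 0}) * prod_list (map w x))"
  proof (intro sum_mono mult_right_mono prod_list_map_nonneg w)
    fix x assume x: "x \<in> A"
    then have "{j. j < length x \<and> x ! j = 0} = {j\<in>{k..<n}. x ! j = 0}"
      using len[OF x] by (auto simp: A_def intro: leI)
    then have "count_list x 0 = card {j\<in>{k..<n}. x ! j = 0}"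
      by (simp add: count_eq_card)
    then show "c * n \<le> real (card {j\<in>{k..<n}. x ! j = 0})"
      using x by (simp add: A_def)
  qed
  also have "\<dots> = real (n - k) * mass w {x\<in>A. x ! k = 0}"
    by (rule mass_nth_swap_invariant[symmetric]) (use n fin len swapA in auto)
  also have "\<dots> \<le> real n * mass w {x\<in>A. x ! k = 0}"
    by (intro mult_right_mono mass_nonneg w) simp
  finally have le: "c * mass w A \<le> mass w {x\<in>A. x ! k = 0}" using n by simp
  have "mass w A = mass w {x\<in>A. x ! k = 0} + mass w {x\<in>A. x ! k \<noteq> 0}"
    unfolding mass_def by (subst sum.union_disjoint[symmetric]) (auto simp: fin intro: sum.cong)
  with le have "mass w {x\<in>A. x ! k \<noteq> 0} \<le> (1 - c) * mass w A" by (simp add: algebra_simps)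
  also have "\<dots> \<le> (1 - c) * ((1 - c) ^ k * mass w (words n))"
    using Suc c by (intro mult_left_mono) (auto simp: A_def)
  also have "{x\<in>A. x ! k \<noteq> 0} = {x\<in>words n. c * n \<le> count_list x 0 \<and> (\<forall>i<Suc k. x ! i \<noteq> 0)}"
    by (auto simp: A_def less_Suc_eq)
  finally show ?case by simp
qed

section \<open>The few-zeros regime\<close>

lemma card_nth_not_one_le:
  assumes "Suc (sum_list x) = length x"
  shows "card {j. j < length x \<and> x ! j \<noteq> 1} \<le> 2 * count_list x 0"
proof -
  \<comment> \<open>This holds letter by letter. Since the numbers \<open>d - 1\<close> add up to
    -1, letters above one cannot outnumber the zeros that compensate them.\<close>
  have "length (filter (\<lambda>d. d \<noteq> 1) x) + length x \<le> 2 * count_list x 0 + sum_list x" for x :: "nat list"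
  proof (induction x)
    case (Cons d x) then show ?case by (cases "d = 0"; cases "d = 1") auto
  qed simp
  from this[of x] show ?thesis using assms by (simp add: length_filter_conv_card)
qed

text \<open>Replacing a prefix \<open>1, \<dots>, 1\<close> of length \<open>K\<close> by \<open>K, 0, \<dots>, 0\<close> preserves length and sum.\<close>

lemma mass_few_zeros_step:
  assumes w: "\<And>k. 0 \<le> w k" and K: "2 \<le> K" "0 < w K" "0 < w 0"
    and n: "4 * (K + w 1 ^ K / (w K * w 0 ^ (K - 1))) * (u + K) \<le> n"
  shows "mass w {x\<in>words n. count_list x 0 \<le> u} \<le> mass w {x\<in>words n. count_list x 0 \<le> u + K} / 2"
proof -
  \<comment> \<open>The factor by which the weight changes when the block
    \<open>K, 0, ..., 0\<close> is turned back into \<open>K\<close> ones.\<close>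
  define s where "s = w 1 ^ K / (w K * w 0 ^ (K - 1))"
  have s: "0 \<le> s" using w K by (simp add: s_def)
  define A where "A v = {x\<in>words n. count_list x 0 \<le> v}" for v
  have fin: "finite (A v)" for v by (simp add: A_def finite_words)
  have len: "length x = n" if "x \<in> A v" for x v using that by (simp add: A_def words_def)
  have sym: "real n * mass w {x\<in>A v. P (x ! i)} =
    (\<Sum>x\<in>A v. real (card {j\<in>{0..<n}. P (x ! j)}) * prod_list (map w x))" if "i < n" for i v P
  proof (rule mass_nth_swap_invariant[where k = 0, simplified diff_zero])
    fix x i j assume "x \<in> A v" "i \<in> {0..<n}" "j \<in> {0..<n}"
    then show "swap_nth i j x \<in> A v" by (simp add: A_def words_swap[where n = n])
  qed (use that fin len in auto)
  have *: "4 * real K * (u + K) + 4 * s * (u + K) \<le> n"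
    using n by (simp add: s_def distrib_left distrib_right)
  \<comment> \<open>\<open>nK\<close> will force most words with few zeros to start with
    \<open>K\<close> ones; \<open>ns\<close> will make the images of these words rare
    enough.\<close>
  have nK: "4 * real K * (u + K) \<le> n" and ns: "4 * s * (u + K) \<le> n"
    using * s by (smt (verit) mult_nonneg_nonneg of_nat_0_le_iff)+
  have "real K \<le> 4 * real K * (u + K)" using K by (simp add: mult_le_cancel_left1)
  then have Kn: "K \<le> n" and n0: "0 < n" using nK K by linarith+
  define B where "B = {x\<in>A u. \<forall>i<K. x ! i = 1}"
  \<comment> \<open>The images lie in \<open>C\<close>: their letter at index 1 is zero because
    \<open>K\<close> is at least 2. By exchangeability this event has relative mass at most
    \<open>(u + K) / n\<close> in \<open>A (u + K)\<close>.\<close>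
  define C where "C = {x\<in>A (u + K). x ! 1 = 0}"
  \<comment> \<open>At most \<open>2 * u\<close> of the \<open>n\<close> letters differ from one, a
    proportion of at most \<open>1 / (2 * K)\<close>. Excluding this at the first \<open>K\<close>
    positions costs at most half of the mass.\<close>
  have "mass w {x\<in>A u. x ! i \<noteq> 1} \<le> mass w (A u) / (2 * K)" if i: "i < K" for i
  proof -
    have "real n * mass w {x\<in>A u. x ! i \<noteq> 1} =
        (\<Sum>x\<in>A u. real (card {j\<in>{0..<n}. x ! j \<noteq> 1}) * prod_list (map w x))"
      using i Kn by (intro sym) simp
    also have "\<dots> \<le> (\<Sum>x\<in>A u. real (2 * u) * prod_list (map w x))"
    proof (intro sum_mono mult_right_mono prod_list_map_nonneg w)
      fix x assume "x \<in> A u"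
      then show "real (card {j\<in>{0..<n}. x ! j \<noteq> 1}) \<le> real (2 * u)"
        using card_nth_not_one_le[of x] by (auto simp: A_def words_def)
    qed
    also have "\<dots> = real (2 * u) * mass w (A u)" by (simp add: mass_def sum_distrib_left)
    also have "\<dots> \<le> n / (2 * K) * mass w (A u)"
    proof (intro mult_right_mono mass_nonneg w)
      have "4 * real K * u \<le> n" using nK K by (simp add: distrib_left) (smt (verit) mult_nonneg_nonneg of_nat_0_le_iff)
      then show "real (2 * u) \<le> n / (2 * K)" using K by (simp add: field_simps)
    qed
    finally show ?thesis using n0 K by (simp add: field_simps)
  qed
  then have "(\<Sum>i<K. mass w {x\<in>A u. x ! i \<noteq> 1}) \<le> (\<Sum>i<K. mass w (A u) / (2 * K))"
    by (intro sum_mono) simp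
  also have "\<dots> = mass w (A u) / 2" using K by simp
  finally have "mass w (\<Union>i<K. {x\<in>A u. x ! i \<noteq> 1}) \<le> mass w (A u) / 2"
    using mass_UN_le[of w "{..<K}" "\<lambda>i. {x\<in>A u. x ! i \<noteq> 1}"] w fin by simp
  moreover have "mass w (A u) \<le> mass w B + mass w (\<Union>i<K. {x\<in>A u. x ! i \<noteq> 1})"
    by (rule order_trans[OF mass_mono mass_Un_le]) (auto simp: B_def w fin)
  ultimately have B: "mass w (A u) \<le> 2 * mass w B" by simp
  \<comment> \<open>Injective on \<open>B\<close>, as the overwritten prefix is the same for all
    words of \<open>B\<close>.\<close>
  define f where "f x = (K # replicate (K - 1) 0) @ drop K x" for x :: "nat list"
  have Bsplit: "x = replicate K 1 @ drop K x" if "x \<in> B" for x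
  proof -
    have "take K x = replicate K 1"
      using that Kn len[of x u] by (auto simp: B_def intro!: nth_equalityI)
    then show ?thesis by (metis append_take_drop_id)
  qed
  have "f x \<in> C" if "x \<in> B" for x
  proof -
    obtain y where x: "x = replicate K 1 @ y" using Bsplit[OF \<open>x \<in> B\<close>] by blast
    have cnt: "count_list (replicate m (a::nat)) b = (if a = b then m else 0)" for m a b
      by (induction m) auto
    have "x \<in> words n" "count_list x 0 \<le> u" using that by (auto simp: B_def A_def)
    then have "f x \<in> words n" "count_list (f x) 0 \<le> u + K"
      using K by (auto simp: x f_def words_def sum_list_replicate cnt)
    moreover have "f x ! 1 = 0" using K by (simp add: f_def nth_append)
    ultimately show ?thesis by (simp add: C_def A_def)
  qed
  then have fB: "f ` B \<subseteq> C" by blast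
  have inj: "inj_on f B"
  proof (rule inj_onI)
    fix x y assume "x \<in> B" "y \<in> B" "f x = f y"
    then show "x = y" using Bsplit[of x] Bsplit[of y] by (simp add: f_def)
  qed
  have wf: "s * prod_list (map w (f x)) = prod_list (map w x)" if x: "x \<in> B" for x
  proof -
    have "prod_list (map w x) = prod_list (map w (replicate K 1 @ drop K x))" using Bsplit[OF x] by simp
    then show ?thesis using K by (simp add: f_def s_def prod_list_replicate)
  qed
  have "mass w B = s * mass w (f ` B)"
    unfolding mass_def sum.reindex[OF inj] sum_distrib_left by (intro sum.cong) (simp_all add: wf)
  also have "\<dots> \<le> s * mass w C"
    using s fB fin by (intro mult_left_mono mass_mono w) (auto simp: C_def)
  finally have BC: "mass w B \<le> s * mass w C" .
  have "real n * mass w C =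
    (\<Sum>x\<in>A (u + K). real (card {j\<in>{0..<n}. x ! j = 0}) * prod_list (map w x))"
    unfolding C_def using K Kn by (intro sym) simp
  also have "\<dots> \<le> (\<Sum>x\<in>A (u + K). real (u + K) * prod_list (map w x))"
  proof (intro sum_mono mult_right_mono prod_list_map_nonneg w)
    fix x assume "x \<in> A (u + K)"
    then show "real (card {j\<in>{0..<n}. x ! j = 0}) \<le> real (u + K)"
      unfolding of_nat_le_iff using count_eq_card[of x 0] by (auto simp: A_def words_def)
  qed
  also have "\<dots> = real (u + K) * mass w (A (u + K))" by (simp add: mass_def sum_distrib_left)
  finally have C: "mass w C \<le> real (u + K) * mass w (A (u + K)) / n" using n0 by (simp add: field_simps)
  have "mass w (A u) \<le> 2 * (s * mass w C)" using B BC by simp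
  also have "\<dots> \<le> 2 * (s * (real (u + K) * mass w (A (u + K)) / n))"
    using s C by (intro mult_left_mono) auto
  also have "\<dots> = (4 * s * (u + K)) / n * mass w (A (u + K)) / 2" by simp
  also have "\<dots> \<le> 1 * mass w (A (u + K)) / 2"
    using ns n0 by (intro divide_right_mono mult_right_mono mass_nonneg w) auto
  finally show ?thesis by (simp add: A_def)
qed

text \<open>Each application of the block replacement halves the mass and raises the threshold by
  \<open>K\<close>; the hypothesis covers the largest threshold, \<open>u + j * K\<close>.\<close>

lemma mass_few_zeros_le:
  assumes w: "\<And>k. 0 \<le> w k" and K: "2 \<le> K" "0 < w K" "0 < w 0"
    and n: "4 * (K + w 1 ^ K / (w K * w 0 ^ (K - 1))) * (u + j * K) \<le> n"
  shows "mass w {x\<in>words n. count_list x 0 \<le> u} \<le> mass w (words n) / 2 ^ j"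
  using n
proof (induction j arbitrary: u)
  case 0
  then show ?case by (auto intro: mass_mono w finite_words)
next
  case (Suc j)
  define D where "D = 4 * (K + w 1 ^ K / (w K * w 0 ^ (K - 1)))"
  have "0 \<le> D" using w K by (simp add: D_def)
  then have "D * real (u + K) \<le> D * real (u + Suc j * K)" by (intro mult_left_mono) auto
  then have "D * real (u + K) \<le> n" using Suc.prems by (simp add: D_def)
  then have "mass w {x\<in>words n. count_list x 0 \<le> u} \<le> mass w {x\<in>words n. count_list x 0 \<le> u + K} / 2"
    using w K unfolding D_def by (intro mass_few_zeros_step)
  also have "\<dots> \<le> mass w (words n) / 2 ^ j / 2"
    using Suc.prems by (intro divide_right_mono Suc.IH) (simp_all add: add_ac)
  finally show ?case by (simp add: mult.commute)
qed

section \<open>Combining the two regimes\<close>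

lemma mass_nonzero_prefix_geometric:
  assumes "weight_sequence w"
  shows "\<exists>\<rho>. 0 < \<rho> \<and> \<rho> < 1 \<and>
    (\<forall>n k. k \<le> n \<longrightarrow> mass w {x\<in>words n. \<forall>i<k. x ! i \<noteq> 0} \<le> 3 * \<rho> ^ k * mass w (words n))"
proof -
  have w: "0 \<le> w k" for k using assms by (simp add: weight_sequence_def)
  obtain K where K: "2 \<le> K" "0 < w K" "0 < w 0" using assms by (auto simp: weight_sequence_def)
  define D where "D = 4 * (K + w 1 ^ K / (w K * w 0 ^ (K - 1)))"
  have "0 \<le> w 1 ^ K / (w K * w 0 ^ (K - 1))" using w K by simp
  then have D: "1 \<le> D" using K by (simp add: D_def)
  \<comment> \<open>Chosen so that starting from the threshold
    \<open>j = \<lfloor>c * n\<rfloor>\<close> the mass can be halved \<open>j\<close> times: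
    \<open>D * (j + j * K) \<le> n\<close>.\<close>
  define c where "c = 1 / (D * (1 + K))"
  have "1 * 1 < D * (1 + K)" using D K by (intro mult_le_less_imp_less) auto
  then have c: "0 < c" "c < 1" by (auto simp: c_def)
  \<comment> \<open>The larger of the two decay rates: \<open>1 - c\<close> for words with many
    zeros, \<open>2 powr - c\<close> for words with few.\<close>
  define \<rho> where "\<rho> = max (1 - c) (2 powr - c)"
  have \<rho>: "0 < \<rho>" "\<rho> < 1" using c by (auto simp: \<rho>_def powr_less_one less_max_iff_disj)
  have "mass w {x\<in>words n. \<forall>i<k. x ! i \<noteq> 0} \<le> 3 * \<rho> ^ k * mass w (words n)" if k: "k \<le> n" for n k
  proof -
    define j where "j = nat \<lfloor>c * n\<rfloor>"
    have j: "real j \<le> c * n" "c * n < real j + 1"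
      using c by (simp_all add: j_def)
    have "D * real (j + j * K) = D * (1 + K) * j" by (simp add: algebra_simps)
    also have "\<dots> \<le> D * (1 + K) * (c * n)" using j D by (intro mult_left_mono) auto
    also have "\<dots> = n" using D by (simp add: c_def)
    finally have "mass w {x\<in>words n. count_list x 0 \<le> j} \<le> mass w (words n) / 2 ^ j"
      using w K unfolding D_def by (intro mass_few_zeros_le)
    also have "\<dots> = 2 powr (- real j) * mass w (words n)"
      by (simp add: powr_minus powr_realpow field_simps)
    also have "\<dots> \<le> (2 * \<rho> ^ k) * mass w (words n)"
    proof (intro mult_right_mono mass_nonneg w)
      \<comment> \<open>Rounding \<open>c * n\<close> down costs a factor 2, and
        \<open>k \<le> n\<close> turns decay in \<open>n\<close> into decay in \<open>k\<close>.
        With the contribution of the words with many zeros this gives the constant 3.\<close>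
      have "2 powr (- real j) \<le> 2 powr (1 + - c * n)" using j by simp
      also have "\<dots> = 2 * (2 powr - c) ^ n"
        by (subst powr_add) (simp add: powr_powr flip: powr_realpow)
      also have "(2 powr - c) ^ n \<le> \<rho> ^ n" by (intro power_mono) (auto simp: \<rho>_def)
      also have "\<rho> ^ n \<le> \<rho> ^ k" using \<rho> k by (intro power_decreasing) auto
      finally show "2 powr (- real j) \<le> 2 * \<rho> ^ k" by simp
    qed
    finally have few: "mass w {x\<in>words n. count_list x 0 \<le> j} \<le> 2 * \<rho> ^ k * mass w (words n)" .
    have "mass w {x\<in>words n. c * n \<le> count_list x 0 \<and> (\<forall>i<k. x ! i \<noteq> 0)} \<le> (1 - c) ^ k * mass w (words n)"
      using w c k by (intro mass_nonzero_prefix_le) auto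
    also have "\<dots> \<le> \<rho> ^ k * mass w (words n)"
      using c by (intro mult_right_mono power_mono mass_nonneg w) (auto simp: \<rho>_def)
    finally have many: "mass w {x\<in>words n. c * n \<le> count_list x 0 \<and> (\<forall>i<k. x ! i \<noteq> 0)}
      \<le> \<rho> ^ k * mass w (words n)" .
    have "mass w {x\<in>words n. \<forall>i<k. x ! i \<noteq> 0} \<le>
        mass w {x\<in>words n. c * n \<le> count_list x 0 \<and> (\<forall>i<k. x ! i \<noteq> 0)} +
        mass w {x\<in>words n. count_list x 0 \<le> j}"
    proof (rule order_trans[OF mass_mono mass_Un_le])
      show "{x\<in>words n. \<forall>i<k. x ! i \<noteq> 0} \<subseteq>
        {x\<in>words n. c * n \<le> count_list x 0 \<and> (\<forall>i<k. x ! i \<noteq> 0)} \<union> {x\<in>words n. count_list x 0 \<le> j}"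
        using j by fastforce
    qed (auto simp: w finite_words)
    then show ?thesis using few many by simp
  qed
  then show ?thesis using \<rho> by blast
qed

section \<open>The tail of the border distance\<close>

lemma finite_vertex_trees: "finite (vertex_trees n)"
  by (simp add: vertex_trees_def finite_plane_trees finite_vertices)

text \<open>Transport along the rotation bijection: rotating only permutes letters, so the weight of
  the word is that of the tree.\<close>

lemma mass_words_conv_vertex_trees:
  "mass w {x\<in>words n. P x} =
    (\<Sum>(T, v)\<in>vertex_trees n. if P (rotated_word (T, v)) then tree_weight w T else 0)"
proof -
  have "mass w {x\<in>words n. P x} = (\<Sum>x\<in>words n. if P x then prod_list (map w x) else 0)"
    unfolding mass_def using finite_words by (rule sum.inter_filter)
  also have "\<dots> = (\<Sum>z\<in>vertex_trees n.
      if P (rotated_word z) then prod_list (map w (rotated_word z)) else 0)"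
    by (rule sum.reindex_bij_betw[OF bij_betw_rotated_word, symmetric])
  also have "\<dots> = (\<Sum>(T, v)\<in>vertex_trees n. if P (rotated_word (T, v)) then tree_weight w T else 0)"
  proof (intro sum.cong refl, clarify)
    fix T v assume "(T, v) \<in> vertex_trees n"
    then have "dfs_word T = dfs_before T v @ dfs_after T v"
      by (simp add: vertex_trees_iff dfs_word_split)
    then have "tree_weight w T = prod_list (map w (rotated_word (T, v)))"
      by (simp add: tree_weight_dfs_word rotated_word_def)
    then show "(if P (rotated_word (T, v)) then prod_list (map w (rotated_word (T, v))) else 0) =
        (if P (rotated_word (T, v)) then tree_weight w T else 0)" by simp
  qed
  finally show ?thesis .
qed

text \<open>All trees of positive probability have \<open>n\<close> vertices, so choosing a uniform
  vertex contributes the constant \<open>1 / n\<close> and the joint law stays proportional to the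
  tree weight.\<close>

lemma pmf_sg_tree_vertex:
  assumes "weight_sequence w" "sg_tree_defined w n"
  shows "pmf (sg_tree_vertex w n) (T, v) =
    (if (T, v) \<in> vertex_trees n then tree_weight w T / (n * partition_function w n) else 0)"
proof -
  have "pmf (sg_tree_vertex w n) (T, v) =
      (\<integral>T'. pmf (map_pmf (Pair T') (pmf_of_set (vertices T'))) (T, v) \<partial>measure_pmf (sg_tree w n))"
    by (simp add: sg_tree_vertex_def pmf_bind map_pmf_def)
  also have "\<dots> = (\<integral>T'. pmf (pmf_of_set (vertices T)) v * indicator {T} T' \<partial>measure_pmf (sg_tree w n))"
  proof (intro Bochner_Integration.integral_cong refl)
    fix T'
    show "pmf (map_pmf (Pair T') (pmf_of_set (vertices T'))) (T, v) =
      pmf (pmf_of_set (vertices T)) v * indicator {T} T'"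
    proof (cases "T' = T")
      case True
      then show ?thesis using pmf_map_inj'[of "Pair T" "pmf_of_set (vertices T)" v] by (simp add: inj_def)
    next
      case False
      then show ?thesis by (auto simp: pmf_eq_0_set_pmf)
    qed
  qed
  also have "\<dots> = pmf (pmf_of_set (vertices T)) v * pmf (sg_tree w n) T"
    by (simp add: measure_pmf_single)
  also have "\<dots> = (if (T, v) \<in> vertex_trees n then tree_weight w T / (n * partition_function w n) else 0)"
    by (auto simp: pmf_sg_tree[OF assms] finite_vertices vertices_nonempty vertex_trees_def plane_trees_def)
  finally show ?thesis .
qed

lemma border_dist_tail:
  assumes w: "weight_sequence w" and n: "sg_tree_defined w n"
    and tail: "mass w {x\<in>words n. \<forall>i<k. x ! i \<noteq> 0} \<le> b * mass w (words n)"
  shows "measure_pmf.prob (sg_tree_vertex w n) {(T, v). k \<le> border_dist T v} \<le> b"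
proof -
  define Z where "Z = n * partition_function w n"
  \<comment> \<open>Every tree is counted once for each of its \<open>n\<close> vertices.\<close>
  have total: "mass w (words n) = Z"
  proof -
    have "mass w (words n) = (\<Sum>(T, v)\<in>vertex_trees n. tree_weight w T)"
      using mass_words_conv_vertex_trees[of w n "\<lambda>_. True"] by simp
    also have "\<dots> = (\<Sum>T\<in>plane_trees n. \<Sum>v\<in>vertices T. tree_weight w T)"
      unfolding vertex_trees_def by (intro sum.Sigma[symmetric]) (auto simp: finite_plane_trees finite_vertices)
    also have "\<dots> = Z"
      by (simp add: Z_def partition_function_def sum_distrib_left plane_trees_def)
    finally show ?thesis .
  qed
  have "n \<noteq> 0"
    using n vertices_nonempty by (auto simp: sg_tree_defined_def plane_trees_def finite_vertices card_gt_0_iff)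
  then have Z: "0 < Z" using partition_function_pos[OF w n] by (simp add: Z_def)
  let ?S = "{z\<in>vertex_trees n. case z of (T, v) \<Rightarrow> k \<le> border_dist T v}"
  have "measure_pmf.prob (sg_tree_vertex w n) {(T, v). k \<le> border_dist T v} =
      measure_pmf.prob (sg_tree_vertex w n) ?S"
    using pmf_sg_tree_vertex[OF w n]
    by (intro measure_pmf.finite_measure_eq_AE) (auto simp: AE_measure_pmf_iff set_pmf_iff split: if_splits)
  also have "\<dots> = (\<Sum>z\<in>?S. pmf (sg_tree_vertex w n) z)"
    by (intro measure_measure_pmf_finite) (simp add: finite_vertex_trees)
  also have "\<dots> = (\<Sum>(T, v)\<in>?S. tree_weight w T / Z)"
    by (intro sum.cong) (auto simp: pmf_sg_tree_vertex[OF w n] Z_def)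
  also have "\<dots> = (\<Sum>(T, v)\<in>vertex_trees n. if k \<le> border_dist T v then tree_weight w T / Z else 0)"
    by (subst sum.inter_filter) (auto simp: finite_vertex_trees intro!: sum.cong)
  \<comment> \<open>The event is enlarged: a border distance of at least \<open>k\<close> forces the
    first \<open>k\<close> letters of the rotated word to be nonzero.\<close>
  also have "\<dots> \<le> (\<Sum>(T, v)\<in>vertex_trees n.
      (if \<forall>i<k. rotated_word (T, v) ! i \<noteq> 0 then tree_weight w T else 0) / Z)"
  proof (intro sum_mono, clarify)
    fix T v assume "(T, v) \<in> vertex_trees n"
    then have "is_vertex T v" by (simp add: vertex_trees_iff)
    then show "(if k \<le> border_dist T v then tree_weight w T / Z else 0) \<le>
        (if \<forall>i<k. rotated_word (T, v) ! i \<noteq> 0 then tree_weight w T else 0) / Z"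
      using rotated_word_border_dist[of T v] tree_weight_nonneg[OF w, of T] Z by auto
  qed
  also have "\<dots> = mass w {x\<in>words n. \<forall>i<k. x ! i \<noteq> 0} / Z"
    unfolding mass_words_conv_vertex_trees by (simp add: sum_divide_distrib case_prod_unfold)
  also have "\<dots> \<le> b" using tail Z by (simp add: total field_simps)
  finally show ?thesis .
qed

text \<open>A word of length \<open>n\<close> and sum \<open>n - 1\<close> contains a zero, which
  bounds the border distance by its index. This settles the tail for \<open>k > n\<close>.\<close>

lemma border_dist_less:
  assumes "(T, v) \<in> vertex_trees n" shows "border_dist T v < n"
proof -
  have "is_vertex T v" "length (dfs_word T) = n" using assms by (auto simp: vertex_trees_iff)
  then have "length (rotated_word (T, v)) = n"
    using arg_cong[OF dfs_word_split[of T v], of length] by (simp add: rotated_word_def)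
  moreover have "\<exists>i<n. rotated_word (T, v) ! i = 0"
  proof (rule ccontr)
    assume "\<not> ?thesis"
    then have "\<forall>d\<in>set (rotated_word (T, v)). 1 \<le> d"
      using \<open>length (rotated_word (T, v)) = n\<close> by (auto simp: in_set_conv_nth Suc_le_eq)
    moreover have "length x \<le> sum_list x" if "\<forall>d\<in>set x. 1 \<le> d" for x :: "nat list"
      using that by (induction x) auto
    moreover have "rotated_word (T, v) \<in> words n"
      using bij_betw_rotated_word[of n] assms by (auto simp: bij_betw_def)
    ultimately show False by (force simp: words_def)
  qed
  ultimately show ?thesis
    using rotated_word_border_dist[OF \<open>is_vertex T v\<close>] by (meson leI order_less_le_trans)
qed

theorem border_dist_geometric_tail:
  assumes "weight_sequence w"
  shows "\<exists>\<rho>. 0 < \<rho> \<and> \<rho> < 1 \<and> (\<forall>n k. sg_tree_defined w n \<longrightarrow>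
    measure_pmf.prob (sg_tree_vertex w n) {(T, v). k \<le> border_dist T v} \<le> 3 * \<rho> ^ k)"
proof -
  obtain \<rho> where \<rho>: "0 < \<rho>" "\<rho> < 1"
    and le: "\<And>n k. k \<le> n \<Longrightarrow> mass w {x\<in>words n. \<forall>i<k. x ! i \<noteq> 0} \<le> 3 * \<rho> ^ k * mass w (words n)"
    using mass_nonzero_prefix_geometric[OF assms] by blast
  have "measure_pmf.prob (sg_tree_vertex w n) {(T, v). k \<le> border_dist T v} \<le> 3 * \<rho> ^ k"
    if n: "sg_tree_defined w n" for n k
  proof (cases "k \<le> n")
    case True
    then show ?thesis using border_dist_tail[OF assms n le] by simp
  next
    case False
    have "AE z in measure_pmf (sg_tree_vertex w n). z \<notin> {(T, v). k \<le> border_dist T v}"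
      using False border_dist_less[of _ _ n] pmf_sg_tree_vertex[OF assms n]
      by (fastforce simp: AE_measure_pmf_iff set_pmf_iff split: if_splits)
    then have "measure_pmf.prob (sg_tree_vertex w n) {(T, v). k \<le> border_dist T v} = 0"
      by (subst measure_pmf.prob_eq_0) auto
    then show ?thesis using \<rho> by simp
  qed
  then show ?thesis using \<rho> by blast
qed

section \<open>Moments and uniform integrability\<close>

text \<open>The crude estimate of \<open>P(X = k)\<close> by \<open>P(X \<ge> k)\<close> suffices,
  since the tail bound is geometric.\<close>

lemma moment_le_of_geometric_tail:
  fixes M :: "'a pmf" and X :: "'a \<Rightarrow> nat"
  assumes tail: "\<And>k. measure_pmf.prob M {x. k \<le> X x} \<le> C * \<rho> ^ k"
  shows "(\<integral>\<^sup>+ x. ennreal (nonneg_power (real (X x)) p) \<partial>measure_pmf M)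
    \<le> (\<Sum>k. ennreal (nonneg_power (real k) p * (C * \<rho> ^ k)))"
proof -
  have nn: "0 \<le> nonneg_power a p" for a by (simp add: nonneg_power_def)
  have "(\<integral>\<^sup>+ x. ennreal (nonneg_power (real (X x)) p) \<partial>measure_pmf M) =
      (\<integral>\<^sup>+ k. ennreal (nonneg_power (real k) p) \<partial>measure_pmf (map_pmf X M))"
    by simp
  also have "\<dots> = (\<Sum>k. ennreal (nonneg_power (real k) p) * ennreal (pmf (map_pmf X M) k))"
    by (simp add: nn_integral_measure_pmf nn_integral_count_space_nat mult.commute)
  also have "\<dots> \<le> (\<Sum>k. ennreal (nonneg_power (real k) p * (C * \<rho> ^ k)))"
  proof (intro suminf_le summableI)
    fix k
    have "pmf (map_pmf X M) k \<le> measure_pmf.prob M {x. k \<le> X x}"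
      unfolding pmf_map by (intro measure_pmf.finite_measure_mono) auto
    with tail[of k] have "pmf (map_pmf X M) k \<le> C * \<rho> ^ k" by linarith
    then show "ennreal (nonneg_power (real k) p) * ennreal (pmf (map_pmf X M) k)
        \<le> ennreal (nonneg_power (real k) p * (C * \<rho> ^ k))"
      using nn by (auto simp flip: ennreal_mult intro!: ennreal_leI mult_left_mono)
  qed
  finally show ?thesis .
qed

lemma summable_nonneg_power_geometric:
  assumes "0 < \<rho>" "\<rho> < 1" "0 \<le> p"
  shows "summable (\<lambda>k. nonneg_power (real k) p * (C * \<rho> ^ k))"
proof (rule summable_comparison_test_bigo)
  have "(\<lambda>k. nonneg_power (real k) p) \<in> O(\<lambda>k. real k powr p)"
    by (intro landau_o.big_mono eventually_mono[OF eventually_gt_at_top[of 0]])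
      (auto simp: nonneg_power_def)
  moreover have "(\<lambda>k. C * \<rho> ^ k) \<in> O(\<lambda>k. \<rho> ^ k)" by simp
  ultimately have "(\<lambda>k. nonneg_power (real k) p * (C * \<rho> ^ k)) \<in> O(\<lambda>k. real k powr p * \<rho> ^ k)"
    by (rule landau_o.big.mult)
  also have "(\<lambda>k. real k powr p * \<rho> ^ k) \<in> O(\<lambda>k. 1 / real k ^ 2)"
    using assms by real_asymp
  finally show "(\<lambda>k. nonneg_power (real k) p * (C * \<rho> ^ k)) \<in> O(\<lambda>k. 1 / real k ^ 2)" .
  show "summable (\<lambda>k. norm (1 / real k ^ 2))"
    using inverse_power_summable[of 2, where ?'a = real] by (simp add: field_simps)
qed

section \<open>Uniform integrability from second moments\<close>

lemma nonneg_power_double: "nonneg_power x (2 * p) = (nonneg_power x p)\<^sup>2"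
  by (simp add: nonneg_power_def power2_eq_square flip: powr_add)

text \<open>Where \<open>\<bar>X\<bar>\<close> exceeds \<open>K\<close>, it is at most the square of
  \<open>X\<close> divided by \<open>K\<close>, so the truncated expectations are at most
  \<open>B / K\<close> uniformly in the index.\<close>

lemma uniformly_integrable_of_second_moment:
  assumes "\<And>i. i \<in> I \<Longrightarrow> X i \<in> borel_measurable (M i)" and B: "B < \<infinity>"
    and le: "\<And>i. i \<in> I \<Longrightarrow> (\<integral>\<^sup>+ x. ennreal ((X i x)\<^sup>2) \<partial>M i) \<le> B"
  shows "uniformly_integrable I M X"
  unfolding uniformly_integrable_def
proof (intro conjI ballI assms(1))
  have bound: "(SUP i\<in>I. \<integral>\<^sup>+ x. ennreal \<bar>X i x\<bar> * indicator {x. K < \<bar>X i x\<bar>} x \<partial>M i) \<le> ennreal (1 / K) * B"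
    if K: "0 < K" for K :: real
  proof (rule SUP_least)
    fix i assume i: "i \<in> I"
    note [measurable] = assms(1)[OF i]
    have "ennreal \<bar>X i x\<bar> * indicator {x. K < \<bar>X i x\<bar>} x \<le> ennreal (1 / K) * ennreal ((X i x)\<^sup>2)" for x
    proof (cases "K < \<bar>X i x\<bar>")
      case True
      then have "\<bar>X i x\<bar> * K \<le> \<bar>X i x\<bar> * \<bar>X i x\<bar>" by (intro mult_left_mono) auto
      then have "\<bar>X i x\<bar> \<le> 1 / K * (X i x)\<^sup>2" using K by (simp add: field_simps power2_eq_square)
      then show ?thesis using True K by (simp flip: ennreal_mult)
    qed simp
    then have "(\<integral>\<^sup>+ x. ennreal \<bar>X i x\<bar> * indicator {x. K < \<bar>X i x\<bar>} x \<partial>M i) \<le>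
        (\<integral>\<^sup>+ x. ennreal (1 / K) * ennreal ((X i x)\<^sup>2) \<partial>M i)"
      by (intro nn_integral_mono)
    also have "\<dots> = ennreal (1 / K) * (\<integral>\<^sup>+ x. ennreal ((X i x)\<^sup>2) \<partial>M i)"
      by (rule nn_integral_cmult) measurable
    also have "\<dots> \<le> ennreal (1 / K) * B" by (intro mult_left_mono le i) simp
    finally show "(\<integral>\<^sup>+ x. ennreal \<bar>X i x\<bar> * indicator {x. K < \<bar>X i x\<bar>} x \<partial>M i) \<le> ennreal (1 / K) * B" .
  qed
  obtain b where b: "0 \<le> b" "B = ennreal b" using B by (cases B) auto
  have "((\<lambda>K. ennreal (1 / K * b)) \<longlongrightarrow> ennreal 0) at_top"
    by (intro tendsto_ennrealI tendsto_mult_left_zero tendsto_divide_0[OF tendsto_const]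
        filterlim_at_top_imp_at_infinity filterlim_ident)
  then have lim: "((\<lambda>K. ennreal (1 / K * b)) \<longlongrightarrow> 0) at_top" by simp
  show "((\<lambda>K::real. SUP i\<in>I. \<integral>\<^sup>+ x. ennreal \<bar>X i x\<bar> * indicator {x. K < \<bar>X i x\<bar>} x \<partial>M i) \<longlongrightarrow> 0) at_top"
  proof (rule tendsto_sandwich[OF _ _ tendsto_const lim])
    show "\<forall>\<^sub>F K in at_top. (SUP i\<in>I. \<integral>\<^sup>+ x. ennreal \<bar>X i x\<bar> * indicator {x. K < \<bar>X i x\<bar>} x \<partial>M i)
        \<le> ennreal (1 / K * b)"
      using eventually_gt_at_top[of "0 :: real"]
    proof eventually_elim
      case (elim K)
      then show ?case using bound[OF elim] b by (simp flip: ennreal_mult)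
    qed
  qed simp
qed

theorem lemma6p4:
  fixes w :: "nat \<Rightarrow> real"
  assumes "weight_sequence w"
    and "type_I w \<or> type_II w \<or> type_III w"
  shows "(\<exists>n0\<ge>1. \<forall>p\<ge>0.
            (SUP n\<in>{n. n0 \<le> n \<and> sg_tree_defined w n}.
               \<integral>\<^sup>+ (T, v). ennreal (nonneg_power (real (border_dist T v)) p)
                 \<partial>measure_pmf (sg_tree_vertex w n)) < \<infinity>)
       \<and> (\<forall>p\<ge>0. uniformly_integrable {n. 1 \<le> n \<and> sg_tree_defined w n}
            (\<lambda>n. measure_pmf (sg_tree_vertex w n))
            (\<lambda>n (T, v). nonneg_power (real (border_dist T v)) p))"
proof -
  obtain \<rho> where \<rho>: "0 < \<rho>" "\<rho> < 1" and tail: "\<And>n k. sg_tree_defined w n \<Longrightarrow>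
    measure_pmf.prob (sg_tree_vertex w n) {(T, v). k \<le> border_dist T v} \<le> 3 * \<rho> ^ k"
    using border_dist_geometric_tail[OF assms(1)] by blast
  \<comment> \<open>A bound for the moment of order \<open>p\<close> that does not depend on
    \<open>n\<close>; hence \<open>n0 = 1\<close> will do.\<close>
  define B where "B p = (\<Sum>k. ennreal (nonneg_power (real k) p * (3 * \<rho> ^ k)))" for p
  have B: "B p < \<infinity>" if "0 \<le> p" for p
    using summable_nonneg_power_geometric[OF \<rho> that, of 3] \<rho>
    by (simp add: B_def suminf_ennreal2 nonneg_power_def less_top[symmetric])
  have moment: "(\<integral>\<^sup>+ (T, v). ennreal (nonneg_power (real (border_dist T v)) p)
      \<partial>measure_pmf (sg_tree_vertex w n)) \<le> B p" if "sg_tree_defined w n" for n p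
    using moment_le_of_geometric_tail[of "sg_tree_vertex w n" "\<lambda>(T, v). border_dist T v" 3 \<rho> p]
      tail[OF that] by (simp add: B_def case_prod_unfold)
  have "(SUP n\<in>{n. 1 \<le> n \<and> sg_tree_defined w n}.
      \<integral>\<^sup>+ (T, v). ennreal (nonneg_power (real (border_dist T v)) p)
        \<partial>measure_pmf (sg_tree_vertex w n)) < \<infinity>" if "0 \<le> p" for p
    using B[OF that] moment[of _ p] by (intro le_less_trans[OF SUP_least]) auto
  moreover have "uniformly_integrable {n. 1 \<le> n \<and> sg_tree_defined w n}
      (\<lambda>n. measure_pmf (sg_tree_vertex w n))
      (\<lambda>n (T, v). nonneg_power (real (border_dist T v)) p)" if "0 \<le> p" for p
  \<comment> \<open>The second moment of the power of order \<open>p\<close> is the moment of order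
    \<open>2 * p\<close>.\<close>
  proof (rule uniformly_integrable_of_second_moment)
    show "B (2 * p) < \<infinity>" using that by (intro B) simp
    fix n assume "n \<in> {n. 1 \<le> n \<and> sg_tree_defined w n}"
    then show "(\<integral>\<^sup>+ z. ennreal ((case z of (T, v) \<Rightarrow> nonneg_power (real (border_dist T v)) p)\<^sup>2)
        \<partial>measure_pmf (sg_tree_vertex w n)) \<le> B (2 * p)"
      using moment[of n "2 * p"] by (simp add: nonneg_power_double case_prod_unfold)
  qed simp
  ultimately show ?thesis by (intro conjI exI[of _ 1]) auto
qed

end
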